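(* Let $n\ge2$ and let $T_1,\dots,T_k$ be all the noncrossing alternating spanning trees of the complete graph $K_n$ on $[n]$. Let $\mathcal{V}(P_n)$ be the vertex figure of $\mathcal{P}(P_n)$ at $0$. Then $\mathcal{P}(T_1)\cap\mathcal{V}(P_n),\dots,\mathcal{P}(T_k)\cap\mathcal{V}(P_n)$ are the top-dimensional simplices of a triangulation of $\mathcal{V}(P_n)$. Moreover, for any $i_1,\dots,i_l\in[k]$, $$\mathcal{P}(T_{i_1})\cap\cdots\cap\mathcal{P}(T_{i_l})\cap\mathcal{V}(P_n)=\mathcal{P}(T_{i_1}\cap\cdots\cap T_{i_l})\cap\mathcal{V}(P_n),$$ where $T_{i_1}\cap\cdots\cap T_{i_l}$ is the graph on $[n]$ with edge set $E(T_{i_1})\cap\cdots\cap E(T_{i_l})$.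
   Context: Let $e_1,\dots,e_n$ be the standard basis of $\mathbb{R}^n$ and $\Phi^+=\{e_i-e_j:1\le i<j\le n\}$. For a graph $G$ on $[n]$ (edges $(i,j)$ with $i<j$), let $\mathcal{C}(G)$ be the cone of nonnegative combinations of $\{e_i-e_j:(i,j)\in E(G)\}$, and define the root polytope $\mathcal{P}(G)=\mathrm{ConvHull}(\{0\}\cup(\Phi^+\cap\mathcal{C}(G)))$. Let $P_n$ be the path graph with edges $(i,i+1)$, $i\in[n-1]$, so $\mathcal{P}(P_n)=\mathrm{ConvHull}(0,e_i-e_j:1\le i<j\le n)$. The vertex figure $\mathcal{V}(P_n)$ is $\mathcal{P}(P_n)\cap\mathcal{H}$ for a hyperplane $\mathcal{H}$ having $0$ strictly on one side and all other vertices of $\mathcal{P}(P_n)$ strictly on the other side. A graph on $[n]$ is noncrossing if there are no $i<j<k<l$ with $(i,k)$ and $(j,l)$ both edges. It is alternating if there are no $i<j<k$ with $(i,j)$ and $(j,k)$ both edges. *)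

theory Defs
  imports "HOL-Analysis.Analysis"
begin

(* A graph on [n] = {1..n} is its edge set, a set of pairs (i, j) with i < j; the vertex set is
   always all of {1..n}. *)

definition complete_graph :: "nat \<Rightarrow> (nat \<times> nat) set" where
  "complete_graph n = {(i, j). 1 \<le> i \<and> i < j \<and> j \<le> n}"

definition path_graph :: "nat \<Rightarrow> (nat \<times> nat) set" where
  "path_graph n = {(i, i + 1) | i. 1 \<le> i \<and> i + 1 \<le> n}"

definition adjacent :: "(nat \<times> nat) set \<Rightarrow> nat \<Rightarrow> nat \<Rightarrow> bool" where
  "adjacent E u v \<longleftrightarrow> (u, v) \<in> E \<or> (v, u) \<in> E"

definition connected_graph :: "nat \<Rightarrow> (nat \<times> nat) set \<Rightarrow> bool" where
  "connected_graph n E \<longleftrightarrow> (\<forall>u\<in>{1..n}. \<forall>v\<in>{1..n}. (adjacent E)\<^sup>*\<^sup>* u v)"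

(* Undirected cycles, listed by their vertices; in particular a single edge is not a cycle. *)
definition is_cycle :: "(nat \<times> nat) set \<Rightarrow> nat list \<Rightarrow> bool" where
  "is_cycle E vs \<longleftrightarrow> 3 \<le> length vs \<and> distinct vs \<and>
     (\<forall>m. m + 1 < length vs \<longrightarrow> adjacent E (vs ! m) (vs ! (m + 1))) \<and>
     adjacent E (last vs) (hd vs)"

definition acyclic_graph :: "(nat \<times> nat) set \<Rightarrow> bool" where
  "acyclic_graph E \<longleftrightarrow> (\<nexists>vs. is_cycle E vs)"

definition spanning_tree :: "nat \<Rightarrow> (nat \<times> nat) set \<Rightarrow> bool" where
  "spanning_tree n T \<longleftrightarrow> T \<subseteq> complete_graph n \<and> connected_graph n T \<and> acyclic_graph T"

definition noncrossing :: "(nat \<times> nat) set \<Rightarrow> bool" where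
  "noncrossing E \<longleftrightarrow> \<not> (\<exists>i j k l. i < j \<and> j < k \<and> k < l \<and> (i, k) \<in> E \<and> (j, l) \<in> E)"

definition alternating :: "(nat \<times> nat) set \<Rightarrow> bool" where
  "alternating E \<longleftrightarrow> \<not> (\<exists>i j k. i < j \<and> j < k \<and> (i, j) \<in> E \<and> (j, k) \<in> E)"

definition noncrossing_alternating_trees :: "nat \<Rightarrow> (nat \<times> nat) set set" where
  "noncrossing_alternating_trees n = {T. spanning_tree n T \<and> noncrossing T \<and> alternating T}"

(* Below, e 1, ..., e n is an enumeration of the standard basis of the ambient n-dimensional
   Euclidean space. *)

definition positive_roots :: "(nat \<Rightarrow> 'a::euclidean_space) \<Rightarrow> nat \<Rightarrow> 'a set" where
  "positive_roots e n = {e i - e j | i j. 1 \<le> i \<and> i < j \<and> j \<le> n}"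

definition graph_cone :: "(nat \<Rightarrow> 'a::euclidean_space) \<Rightarrow> (nat \<times> nat) set \<Rightarrow> 'a set" where
  "graph_cone e E =
     {\<Sum>(i, j)\<in>E. c (i, j) *\<^sub>R (e i - e j) | c :: nat \<times> nat \<Rightarrow> real. \<forall>p\<in>E. 0 \<le> c p}"

definition root_polytope ::
  "(nat \<Rightarrow> 'a::euclidean_space) \<Rightarrow> nat \<Rightarrow> (nat \<times> nat) set \<Rightarrow> 'a set" where
  "root_polytope e n E = convex hull (insert 0 (positive_roots e n \<inter> graph_cone e E))"

(* F is a vertex figure of P at v. The hyperplane {x. a \<bullet> x = b} may be oriented so that v
   is on the side a \<bullet> x < b, since (a, b) and (-a, -b) define the same hyperplane. *)
definition is_vertex_figure :: "'a::euclidean_space \<Rightarrow> 'a set \<Rightarrow> 'a set \<Rightarrow> bool" where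
  "is_vertex_figure v P F \<longleftrightarrow>
     (\<exists>a b. a \<noteq> 0 \<and> a \<bullet> v < b \<and>
        (\<forall>w. w extreme_point_of P \<and> w \<noteq> v \<longrightarrow> b < a \<bullet> w) \<and>
        F = P \<inter> {x. a \<bullet> x = b})"

(* The library's triangulation predicate neither mentions the underlying set nor asks for closure
   under faces, so triangulations of a given set are based on simplicial_complex instead. *)
definition triangulation_of :: "'a::euclidean_space set set \<Rightarrow> 'a set \<Rightarrow> bool" where
  "triangulation_of \<C> V \<longleftrightarrow> simplicial_complex \<C> \<and> \<Union>\<C> = V"

definition top_simplices :: "'a::euclidean_space set set \<Rightarrow> 'a set \<Rightarrow> 'a set set" where
  "top_simplices \<C> V = {S \<in> \<C>. aff_dim S = aff_dim V}"

end

theory Submission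
  imports Defs
begin

text \<open>
  A nonnegative flow with noncrossing alternating support is determined by its excesses x, whatever
  the support: if j is the first sink and i the last source before j, another edge out of i and another edge into j
  would cross, so the edge (i, j) carries min (x i) (- x j); removing it and repeating determines
  the flow, and the same greedy procedure constructs one for every point of the cone of the complete
  graph. Therefore the cones of noncrossing alternating graphs are simplicial, cover the whole cone,
  and intersect in the cones of the common subgraphs. Such a graph has full dimension iff its roots
  span all roots, that is, iff it is connected; linear independence excludes cycles.

  All positive roots lie on a sphere around 0, so they are extreme points of the root polytope and
  hence beyond the hyperplane of the vertex figure. This is why slicing the root polytope of a graph
  by this hyperplane is the same as slicing its cone.
\<close>

section \<open>Flows on noncrossing alternating graphs\<close>

text \<open>Connectedness is left out so that the class is closed under subgraphs; these index the
  lower-dimensional simplices of the triangulation.\<close>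

definition na_graph :: "nat \<Rightarrow> (nat \<times> nat) set \<Rightarrow> bool" where
  "na_graph n F \<longleftrightarrow> F \<subseteq> complete_graph n \<and> noncrossing F \<and> alternating F"

definition supp :: "(nat \<times> nat \<Rightarrow> real) \<Rightarrow> (nat \<times> nat) set" where
  "supp c = {p. c p \<noteq> 0}"

text \<open>With \<open>c\<close> read as a flow from smaller to larger vertices, this is the excess
  at \<open>v\<close>. It becomes the coordinate along \<open>e v\<close> of the point that
  \<open>c\<close> represents.\<close>

definition net :: "nat \<Rightarrow> (nat \<times> nat \<Rightarrow> real) \<Rightarrow> nat \<Rightarrow> real" where
  "net n c v = (\<Sum>p\<in>complete_graph n. c p * (of_bool (fst p = v) - of_bool (snd p = v)))"

text \<open>The support lies in the complete graph, so a flow vanishes at all other pairs and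
  uniqueness can be stated as equality of functions.\<close>

definition na_flow :: "nat \<Rightarrow> (nat \<times> nat \<Rightarrow> real) \<Rightarrow> bool" where
  "na_flow n c \<longleftrightarrow> (\<forall>p. 0 \<le> c p) \<and> na_graph n (supp c)"

lemma finite_complete_graph [simp]: "finite (complete_graph n)"
  by (rule finite_subset[of _ "{1..n} \<times> {1..n}"]) (auto simp: complete_graph_def)

lemma na_graph_subset:
  assumes "na_graph n F" "F' \<subseteq> F"
  shows "na_graph n F'"
proof -
  have "noncrossing F'"
    using assms unfolding na_graph_def noncrossing_def by blast
  moreover have "alternating F'"
    using assms unfolding na_graph_def alternating_def by blast
  ultimately show ?thesis
    using assms unfolding na_graph_def by blast
qed

lemma na_graph_finite: "na_graph n F \<Longrightarrow> finite F"
  unfolding na_graph_def using finite_subset finite_complete_graph by blast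

lemma na_graphD:
  assumes "na_graph n F"
  shows "(i, j) \<in> F \<Longrightarrow> 1 \<le> i \<and> i < j \<and> j \<le> n"
    and "(i, j) \<in> F \<Longrightarrow> (j, k) \<notin> F"
    and "i < j \<Longrightarrow> j < k \<Longrightarrow> k < l \<Longrightarrow> (i, k) \<in> F \<Longrightarrow> (j, l) \<notin> F"
proof -
  show *: "1 \<le> i \<and> i < j \<and> j \<le> n" if "(i, j) \<in> F" for i j
    using assms that by (auto simp: na_graph_def complete_graph_def)
  show "(i, j) \<in> F \<Longrightarrow> (j, k) \<notin> F"
    using * assms unfolding na_graph_def alternating_def by blast
  show "i < j \<Longrightarrow> j < k \<Longrightarrow> k < l \<Longrightarrow> (i, k) \<in> F \<Longrightarrow> (j, l) \<notin> F"
    using assms unfolding na_graph_def noncrossing_def by blast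
qed

lemma net_upd:
  assumes "p \<in> complete_graph n"
  shows "net n (c(p := z)) v = net n c v + (z - c p) * (of_bool (fst p = v) - of_bool (snd p = v))"
proof -
  have "(\<Sum>q\<in>complete_graph n - {p}. (c(p := z)) q * (of_bool (fst q = v) - of_bool (snd q = v)))
      = (\<Sum>q\<in>complete_graph n - {p}. c q * (of_bool (fst q = v) - of_bool (snd q = v)))"
    by (intro sum.cong) auto
  then show ?thesis
    unfolding net_def using assms by (simp add: sum.remove[where x = p] algebra_simps)
qed

text \<open>By alternation the tail of a support edge is never the head of another, so nothing is
  subtracted from the outflow. \<open>net_sink\<close> is the mirror image.\<close>

lemma net_source:
  assumes "na_flow n c" "(u, w) \<in> supp c"
  shows "net n c u = (\<Sum>p\<in>complete_graph n. c p * of_bool (fst p = u))"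
proof -
  have "p \<notin> supp c" if "snd p = u" for p
    using assms that na_graphD(2)[of n "supp c" "fst p" u w] by (auto simp: na_flow_def)
  then show ?thesis
    unfolding net_def by (intro sum.cong) (auto simp: supp_def)
qed

lemma net_sink:
  assumes "na_flow n c" "(u, w) \<in> supp c"
  shows "- net n c w = (\<Sum>p\<in>complete_graph n. c p * of_bool (snd p = w))"
proof -
  have "p \<notin> supp c" if "fst p = w" for p
    using assms that na_graphD(2)[of n "supp c" u w "snd p"] by (cases p) (auto simp: na_flow_def)
  then show ?thesis
    unfolding net_def sum_negf[symmetric] by (intro sum.cong) (auto simp: supp_def)
qed

lemma supp_subset_complete: "na_flow n c \<Longrightarrow> supp c \<subseteq> complete_graph n"
  by (simp add: na_flow_def na_graph_def)

lemma net_signs: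
  assumes "na_flow n c" "(u, w) \<in> supp c"
  shows "net n c u \<ge> c (u, w)" "- net n c w \<ge> c (u, w)" "c (u, w) > 0"
proof -
  have nn: "c p \<ge> 0" for p using assms unfolding na_flow_def by blast
  have mem: "(u, w) \<in> complete_graph n" using assms supp_subset_complete by blast
  show "net n c u \<ge> c (u, w)"
    unfolding net_source[OF assms]
    using member_le_sum[OF mem, of "\<lambda>p. c p * of_bool (fst p = u)"] nn by simp
  show "- net n c w \<ge> c (u, w)"
    unfolding net_sink[OF assms]
    using member_le_sum[OF mem, of "\<lambda>p. c p * of_bool (snd p = w)"] nn by simp
  show "c (u, w) > 0" using nn[of "(u, w)"] assms(2) by (simp add: supp_def)
qed

section \<open>Uniqueness of the flow with given excesses\<close>

lemma net_pos_edge: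
  assumes "na_flow n c" "net n c u > 0"
  obtains w where "(u, w) \<in> supp c"
proof -
  have nn: "c p \<ge> 0" for p using assms unfolding na_flow_def by blast
  have "\<exists>w. (u, w) \<in> supp c"
  proof (rule ccontr)
    assume "\<nexists>w. (u, w) \<in> supp c"
    then have "c p = 0" if "fst p = u" for p using that by (cases p) (auto simp: supp_def)
    then have "net n c u \<le> 0"
      unfolding net_def by (intro sum_nonpos) (use nn in auto)
    with assms show False by simp
  qed
  then show ?thesis using that by blast
qed

lemma net_neg_edge:
  assumes "na_flow n c" "net n c w < 0"
  obtains u where "(u, w) \<in> supp c"
proof -
  have nn: "c p \<ge> 0" for p using assms unfolding na_flow_def by blast
  have "\<exists>u. (u, w) \<in> supp c"
  proof (rule ccontr)
    assume "\<nexists>u. (u, w) \<in> supp c"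
    then have "c p = 0" if "snd p = w" for p using that by (cases p) (auto simp: supp_def)
    then have "net n c w \<ge> 0"
      unfolding net_def by (intro sum_nonneg) (use nn in auto)
    with assms show False by simp
  qed
  then show ?thesis using that by blast
qed

text \<open>If the edge exhausted neither excess, there would be further support edges
  \<open>(i, l)\<close> and \<open>(k, j)\<close>. As a sink, \<open>l\<close> cannot precede
  \<open>j\<close>; as a source before \<open>j\<close>, \<open>k\<close> cannot follow
  \<open>i\<close>. Hence \<open>k < i < j < l\<close> and the two edges cross.\<close>

lemma peel_value:
  assumes c: "na_flow n c" and ij: "i < j" and pos: "net n c i > 0" and neg: "net n c j < 0"
    and before: "\<And>v. v < j \<Longrightarrow> net n c v \<ge> 0"
    and between: "\<And>v. i < v \<Longrightarrow> v < j \<Longrightarrow> net n c v \<le> 0"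
  shows "c (i, j) = min (net n c i) (- net n c j)"
proof -
  have nn: "c p \<ge> 0" for p using c unfolding na_flow_def by blast
  have na: "na_graph n (supp c)" using c by (simp add: na_flow_def)
  obtain w where w: "(i, w) \<in> supp c" using net_pos_edge[OF c pos] .
  obtain u where u: "(u, j) \<in> supp c" using net_neg_edge[OF c neg] .
  have i1: "1 \<le> i" using na_graphD(1)[OF na w] by simp
  have jn: "j \<le> n" using na_graphD(1)[OF na u] by simp
  have mem: "(i, j) \<in> complete_graph n" using i1 jn ij by (simp add: complete_graph_def)
  note net_i = net_source[OF c w] and net_j = net_sink[OF c u]
  have "c (i, j) \<le> net n c i"
    unfolding net_i using member_le_sum[OF mem, of "\<lambda>p. c p * of_bool (fst p = i)"] nn by simp
  moreover have "c (i, j) \<le> - net n c j"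
    unfolding net_j using member_le_sum[OF mem, of "\<lambda>p. c p * of_bool (snd p = j)"] nn by simp
  moreover have "c (i, j) = net n c i \<or> c (i, j) = - net n c j"
  proof (rule ccontr)
    assume ne: "\<not> (c (i, j) = net n c i \<or> c (i, j) = - net n c j)"
    have "\<exists>l. l \<noteq> j \<and> (i, l) \<in> supp c"
    proof (rule ccontr)
      assume "\<nexists>l. l \<noteq> j \<and> (i, l) \<in> supp c"
      then have "c p * of_bool (fst p = i) = (if p = (i, j) then c p else 0)" for p
        by (cases p) (auto simp: supp_def)
      then have "net n c i = c (i, j)" unfolding net_i using mem by simp
      with ne show False by simp
    qed
    then obtain l where l: "l \<noteq> j" "(i, l) \<in> supp c" by blast
    have "\<exists>k. k \<noteq> i \<and> (k, j) \<in> supp c"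
    proof (rule ccontr)
      assume "\<nexists>k. k \<noteq> i \<and> (k, j) \<in> supp c"
      then have "c p * of_bool (snd p = j) = (if p = (i, j) then c p else 0)" for p
        by (cases p) (auto simp: supp_def)
      then have "- net n c j = c (i, j)" unfolding net_j using mem by simp
      with ne show False by simp
    qed
    then obtain k where k: "k \<noteq> i" "(k, j) \<in> supp c" by blast
    have "l > j" using before[of l] net_signs[OF c l(2)] l(1) by force
    moreover have "k < i" using between[of k] net_signs[OF c k(2)] na_graphD(1)[OF na k(2)] k(1)
      by force
    ultimately show False using na_graphD(3)[OF na _ ij _ k(2)] l(2) by blast
  qed
  ultimately show ?thesis by linarith
qed

lemma na_flow_delete:
  assumes "na_flow n c"
  shows "na_flow n (c(p := 0))"
proof -
  have "supp (c(p := 0)) \<subseteq> supp c" by (auto simp: supp_def)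
  then show ?thesis using assms na_graph_subset unfolding na_flow_def by auto
qed

text \<open>This selects the edge that both the uniqueness and the existence proof peel off. The
  second assumption keeps the first negative value from having only zeros before it.\<close>

lemma first_sink:
  fixes x :: "nat \<Rightarrow> real"
  assumes "x v < 0" and "\<And>w. x w < 0 \<Longrightarrow> (\<forall>u<w. x u \<ge> 0) \<Longrightarrow> \<exists>u<w. x u > 0"
  obtains i j where "i < j" "x i > 0" "x j < 0" "\<And>u. u < j \<Longrightarrow> x u \<ge> 0"
    "\<And>u. i < u \<Longrightarrow> u < j \<Longrightarrow> x u \<le> 0"
proof -
  define j where "j = (LEAST w. x w < 0)"
  have j: "x j < 0" unfolding j_def by (rule LeastI[of "\<lambda>w. x w < 0", OF assms(1)])
  have before: "x u \<ge> 0" if "u < j" for u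
    using not_less_Least[of u "\<lambda>w. x w < 0"] that unfolding j_def by force
  define A where "A = {u. u < j \<and> x u > 0}"
  have A: "finite A" "A \<noteq> {}" using assms(2)[OF j] before unfolding A_def by auto
  have "Max A \<in> A" using A by simp
  moreover have "x u \<le> 0" if "Max A < u" "u < j" for u
  proof -
    have "u \<notin> A" using Max_ge[OF A(1), of u] that by auto
    then show ?thesis using that by (simp add: A_def)
  qed
  ultimately show ?thesis using that[of "Max A" j] j before unfolding A_def by blast
qed

text \<open>Induction on the support of \<open>c\<close>: by \<open>peel_value\<close> the flow on
  the selected edge depends only on the excesses, so \<open>c\<close> and \<open>d\<close> agree
  there, and deleting the edge from both keeps their excesses equal.\<close>

lemma na_flow_unique:
  assumes "na_flow n c" "na_flow n d" "\<And>v. net n c v = net n d v"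
  shows "c = d"
  using assms
proof (induction "card (supp c)" arbitrary: c d rule: less_induct)
  case less
  note c = less.prems(1) and d = less.prems(2) and eq = less.prems(3)
  show ?case
  proof (cases "supp c = {}")
    case True
    then have c0: "c = (\<lambda>_. 0)" by (auto simp: supp_def)
    then have "net n d v = 0" for v using eq[of v] by (simp add: net_def)
    then have "supp d = {}" using net_signs[OF d] by fastforce
    then show ?thesis using c0 by (auto simp: supp_def)
  next
    case False
    then obtain u v where "(u, v) \<in> supp c" by auto
    then have v: "net n c v < 0" using net_signs[OF c] by fastforce
    have "\<exists>u<w. net n c u > 0" if w: "net n c w < 0" for w
    proof -
      obtain u where u: "(u, w) \<in> supp c" using net_neg_edge[OF c w] .
      then show ?thesis
        using net_signs[OF c u] c na_graphD(1)[of n "supp c" u w] by (force simp: na_flow_def)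
    qed
    then obtain i j where ij: "i < j" "net n c i > 0" "net n c j < 0"
        "\<And>u. u < j \<Longrightarrow> net n c u \<ge> 0" "\<And>u. i < u \<Longrightarrow> u < j \<Longrightarrow> net n c u \<le> 0"
      using first_sink[of "net n c" v] v by metis
    have cv: "c (i, j) = min (net n c i) (- net n c j)"
      using peel_value[OF c] ij by blast
    have dv: "d (i, j) = min (net n c i) (- net n c j)"
      using peel_value[OF d] ij eq by metis
    have pos: "c (i, j) > 0" using cv ij by simp
    then have mem: "(i, j) \<in> supp c" by (simp add: supp_def)
    then have K: "(i, j) \<in> complete_graph n" using supp_subset_complete[OF c] by blast
    have "supp (c((i, j) := 0)) = supp c - {(i, j)}" by (auto simp: supp_def)
    moreover have "finite (supp c)" using c na_graph_finite by (auto simp: na_flow_def)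
    ultimately have "card (supp (c((i, j) := 0))) < card (supp c)"
      using mem card_Diff1_less by metis
    then have "c((i, j) := 0) = d((i, j) := 0)"
      by (rule less.hyps) (use c d eq cv dv in \<open>auto simp: na_flow_delete net_upd[OF K]\<close>)
    then show ?thesis using cv dv by (metis fun_upd_triv fun_upd_upd)
  qed
qed

section \<open>Existence of a flow with given excesses\<close>

lemma na_flow_exists_aux:
  assumes "\<And>t. t \<le> n \<Longrightarrow> (\<Sum>v\<in>{1..t}. x v) \<ge> 0" "(\<Sum>v\<in>{1..n}. x v) = 0"
    "\<And>v. v \<notin> {1..n} \<Longrightarrow> x v = 0"
  shows "\<exists>c. na_flow n c \<and> net n c = x"
  using assms
\<comment> \<open>The greedy edge exhausts its source or its sink, so the number of nonzero excesses
  drops.\<close>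
proof (induction "card {v. x v \<noteq> 0}" arbitrary: x rule: less_induct)
  case less
  note S = less.prems(1) and S0 = less.prems(2) and out = less.prems(3)
  show ?case
  proof (cases "\<exists>v. x v < 0")
    case False
    then have "x v = 0" for v
      using S0 out[of v] sum_nonneg_eq_0_iff[of "{1..n}" x] by (metis finite_atLeastAtMost linorder_not_less)
    moreover have "na_flow n (\<lambda>_. 0)"
      by (simp add: na_flow_def supp_def na_graph_def noncrossing_def alternating_def)
    moreover have "net n (\<lambda>_. 0) = (\<lambda>_. 0)" by (auto simp: net_def)
    ultimately show ?thesis by (metis ext)
  next
    case True
    then obtain v where v: "x v < 0" by blast
    \<comment> \<open>With no source before the first sink \<open>w\<close>, the partial sum up to
      \<open>w\<close> would be \<open>x w\<close>, which is negative.\<close>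
    have "\<exists>u<w. x u > 0" if w: "x w < 0" "\<forall>u<w. x u \<ge> 0" for w
    proof (rule ccontr)
      assume "\<not> (\<exists>u<w. x u > 0)"
      then have z: "x u = 0" if "u < w" for u using w(2) that by force
      have wn: "w \<in> {1..n}" using out[of w] w(1) by fastforce
      have "(\<Sum>u\<in>{1..w}. x u) = x w + (\<Sum>u\<in>{1..w} - {w}. x u)"
        using wn by (intro sum.remove) auto
      also have "(\<Sum>u\<in>{1..w} - {w}. x u) = 0" using z by (intro sum.neutral) auto
      finally show False using S[of w] wn w(1) by simp
    qed
    then obtain i j where ij: "i < j" "x i > 0" "x j < 0"
        "\<And>u. u < j \<Longrightarrow> x u \<ge> 0" "\<And>u. i < u \<Longrightarrow> u < j \<Longrightarrow> x u \<le> 0"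
      using first_sink[of x v] v by metis
    have in_n: "i \<in> {1..n}" "j \<in> {1..n}" using out[of i] out[of j] ij by fastforce+
    then have K: "(i, j) \<in> complete_graph n" using ij by (simp add: complete_graph_def)
    \<comment> \<open>The largest amount that can be shipped from \<open>i\<close> to
      \<open>j\<close> without reversing the sign of either excess; it reduces one of them to
      zero.\<close>
    define \<mu> where "\<mu> = min (x i) (- x j)"
    have \<mu>: "\<mu> > 0" "\<mu> \<le> x i" "\<mu> \<le> - x j" using ij by (auto simp: \<mu>_def)
    define y where "y = (\<lambda>v. x v - \<mu> * (of_bool (i = v) - of_bool (j = v)))"
    have yi: "y i = x i - \<mu>" and yj: "y j = x j + \<mu>"
      using ij by (auto simp: y_def)
    have yo: "y v = x v" if "v \<noteq> i" "v \<noteq> j" for v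
      using that by (simp add: y_def)
    have sum_y: "(\<Sum>v\<in>{1..t}. y v) = (\<Sum>v\<in>{1..t}. x v) - \<mu> * (of_bool (i \<le> t) - of_bool (j \<le> t))" for t
      using in_n by (simp add: y_def sum_subtractf sum_distrib_left[symmetric] of_bool_def)
    have "x v \<noteq> 0" if "y v \<noteq> 0" for v
      using that ij(2,3) yo[of v] by (cases "v = i \<or> v = j") auto
    then have "{v. y v \<noteq> 0} \<subseteq> {v. x v \<noteq> 0}" by blast
    moreover have "y i = 0 \<or> y j = 0" using yi yj by (auto simp: \<mu>_def)
    moreover have "x i \<noteq> 0" "x j \<noteq> 0" using ij by auto
    ultimately have "{v. y v \<noteq> 0} \<subset> {v. x v \<noteq> 0}" by blast
    moreover have "finite {v. x v \<noteq> 0}" by (rule finite_subset[of _ "{1..n}"]) (use out in blast)+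
    ultimately have "card {v. y v \<noteq> 0} < card {v. x v \<noteq> 0}" by (rule psubset_card_mono[rotated])
    then have "\<exists>d. na_flow n d \<and> net n d = y"
    proof (rule less.hyps)
      show "(\<Sum>v\<in>{1..t}. y v) \<ge> 0" if "t \<le> n" for t
      \<comment> \<open>Exactly these partial sums lose the shipped amount. Since
        \<open>t < j\<close>, they consist of \<open>x i\<close> and further nonnegative terms, so
        they were at least \<open>x i\<close>.\<close>
      proof (cases "i \<le> t \<and> t < j")
        case True
        have "x i \<le> (\<Sum>v\<in>{1..t}. x v)"
          using True ij in_n by (intro member_le_sum) auto
        then show ?thesis unfolding sum_y using True \<mu> by simp
      next
        case False
        then show ?thesis unfolding sum_y using S[OF that] ij(1) by auto
      qed
      show "(\<Sum>v\<in>{1..n}. y v) = 0" unfolding sum_y using S0 in_n by simp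
      show "y v = 0" if "v \<notin> {1..n}" for v
      proof -
        have "v \<noteq> i" "v \<noteq> j" using that in_n by auto
        then show ?thesis using yo out[OF that] by simp
      qed
    qed
    then obtain d where d: "na_flow n d" "net n d = y" by blast
    define c where "c = d((i, j) := d (i, j) + \<mu>)"
    have nn: "d p \<ge> 0" for p using d(1) unfolding na_flow_def by blast
    have "net n c = x"
      unfolding c_def by (rule ext) (simp only: net_upd[OF K] d(2), simp add: y_def)
    \<comment> \<open>Shipping reverses no sign, so every support edge leads from a source to a sink
      of \<open>x\<close>; alternation follows.\<close>
    have sgn: "x u > 0 \<and> x w < 0" if "(u, w) \<in> supp c" for u w
    proof (cases "(u, w) = (i, j)")
      case True
      then show ?thesis using ij by simp
    next
      case False
      then have "(u, w) \<in> supp d" using that by (auto simp: c_def supp_def)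
      then have "y u > 0" "y w < 0" using net_signs[OF d(1), of u w] d(2) by auto
      then have "u \<noteq> j" "w \<noteq> i" using yi yj \<mu> by auto
      then show ?thesis
        using \<open>y u > 0\<close> \<open>y w < 0\<close> yi yj yo[of u] yo[of w] ij(2,3) by (cases "u = i"; cases "w = j") auto
    qed
    have sub: "supp c \<subseteq> insert (i, j) (supp d)" by (auto simp: c_def supp_def)
    have "alternating (supp c)"
      unfolding alternating_def
    proof clarify
      fix p q r
      assume "(p, q) \<in> supp c" "(q, r) \<in> supp c"
      then show False using sgn[of p q] sgn[of q r] by simp
    qed
    moreover have "noncrossing (supp c)"
      unfolding noncrossing_def
    proof clarify
      fix p q r s
      assume o: "p < q" "q < r" "r < s" and m: "(p, r) \<in> supp c" "(q, s) \<in> supp c"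
      have "\<not> ((p, r) \<in> supp d \<and> (q, s) \<in> supp d)"
        using na_graphD(3)[of n "supp d" p q r s] o d(1) by (auto simp: na_flow_def)
      \<comment> \<open>A crossing must involve the new edge \<open>(i, j)\<close>. The other edge
        would start at a source strictly between \<open>i\<close> and \<open>j\<close>, or end at a
        sink before \<open>j\<close>; the choice of \<open>i\<close> and \<open>j\<close> excludes
        both.\<close>
      then consider "(p, r) = (i, j)" | "(q, s) = (i, j)" using m sub by blast
      then show False
      proof cases
        case 1
        then show ?thesis using sgn[OF m(2)] ij(5)[of q] o by simp
      next
        case 2
        then show ?thesis using sgn[OF m(1)] ij(4)[of r] o by simp
      qed
    qed
    moreover have "supp c \<subseteq> complete_graph n"
      using sub K supp_subset_complete[OF d(1)] by blast
    ultimately have "na_flow n c"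
      using nn \<mu> by (auto simp: na_flow_def na_graph_def c_def add_nonneg_nonneg less_imp_le)
    then show ?thesis using \<open>net n c = x\<close> by blast
  qed
qed

text \<open>All edges lead forward, so the partial sum of the excesses up to \<open>t\<close> is the
  flow from \<open>{1..t}\<close> to later vertices, which is nonnegative and is zero for
  \<open>t = n\<close>.\<close>

lemma na_flow_exists:
  assumes "\<And>p. p \<in> complete_graph n \<Longrightarrow> 0 \<le> c p"
  shows "\<exists>d. na_flow n d \<and> net n d = net n c"
proof (rule na_flow_exists_aux)
  have part: "(\<Sum>v\<in>{1..t}. net n c v)
      = (\<Sum>p\<in>complete_graph n. c p * (of_bool (fst p \<le> t) - of_bool (snd p \<le> t)))" for t
  proof -
    have "(\<Sum>v\<in>{1..t}. net n c v)
      = (\<Sum>p\<in>complete_graph n. \<Sum>v\<in>{1..t}. c p * (of_bool (fst p = v) - of_bool (snd p = v)))"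
      unfolding net_def by (rule sum.swap)
    also have "\<dots> = (\<Sum>p\<in>complete_graph n. c p * (of_bool (fst p \<le> t) - of_bool (snd p \<le> t)))"
      by (intro sum.cong)
         (auto simp: sum_distrib_left[symmetric] sum_subtractf of_bool_def complete_graph_def)
    finally show ?thesis .
  qed
  show "(\<Sum>v\<in>{1..t}. net n c v) \<ge> 0" for t
    unfolding part by (intro sum_nonneg) (use assms in \<open>auto simp: complete_graph_def\<close>)
  show "(\<Sum>v\<in>{1..n}. net n c v) = 0"
    unfolding part by (intro sum.neutral) (auto simp: complete_graph_def)
  show "net n c v = 0" if "v \<notin> {1..n}" for v
    unfolding net_def using that by (intro sum.neutral) (auto simp: complete_graph_def)
qed

section \<open>Cones of noncrossing alternating graphs\<close>

locale root_system_coordinates =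
  fixes n :: nat and e :: "nat \<Rightarrow> 'a::euclidean_space"
  assumes e_bij: "bij_betw e {1..n} Basis"
begin

definition root_vec :: "nat \<times> nat \<Rightarrow> 'a" where
  "root_vec p = e (fst p) - e (snd p)"

text \<open>The sum always runs over the complete graph, so flows with different supports are
  compared under a single map; \<open>comb_supp\<close> returns to the sum over a subgraph.\<close>

definition comb :: "(nat \<times> nat \<Rightarrow> real) \<Rightarrow> 'a" where
  "comb c = (\<Sum>p\<in>complete_graph n. c p *\<^sub>R root_vec p)"

lemma inner_e:
  assumes "i \<in> {1..n}" "j \<in> {1..n}"
  shows "e i \<bullet> e j = of_bool (i = j)"
proof -
  have "e i \<in> Basis" "e j \<in> Basis" using e_bij assms by (auto simp: bij_betw_def)
  moreover have "e i = e j \<longleftrightarrow> i = j"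
    using e_bij assms by (meson bij_betw_def inj_on_eq_iff)
  ultimately show ?thesis by (simp add: inner_Basis)
qed

lemma inner_root:
  assumes "p \<in> complete_graph n" "v \<in> {1..n}"
  shows "root_vec p \<bullet> e v = of_bool (fst p = v) - of_bool (snd p = v)"
  using assms by (auto simp: root_vec_def inner_diff_left inner_e complete_graph_def)

lemma inner_comb:
  assumes "v \<in> {1..n}"
  shows "comb c \<bullet> e v = net n c v"
  using assms by (auto simp: comb_def net_def inner_sum_left inner_root intro!: sum.cong)

lemma net_outside: "v \<notin> {1..n} \<Longrightarrow> net n c v = 0"
  unfolding net_def by (intro sum.neutral) (auto simp: complete_graph_def)

lemma comb_eq_iff: "comb c = comb d \<longleftrightarrow> (\<forall>v. net n c v = net n d v)"
proof
  assume "comb c = comb d"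
  then show "\<forall>v. net n c v = net n d v"
    by (metis inner_comb net_outside)
next
  assume eq: "\<forall>v. net n c v = net n d v"
  show "comb c = comb d"
  proof (rule euclidean_eqI)
    fix b :: 'a assume "b \<in> Basis"
    then have "b \<in> e ` {1..n}" using e_bij by (simp add: bij_betw_def)
    then obtain v where "v \<in> {1..n}" "b = e v" by blast
    then show "comb c \<bullet> b = comb d \<bullet> b" using eq by (simp add: inner_comb)
  qed
qed

lemma comb_unique:
  assumes "na_flow n c" "na_flow n d" "comb c = comb d"
  shows "c = d"
  using na_flow_unique assms comb_eq_iff by blast

lemma comb_supp:
  assumes "supp c \<subseteq> E" "E \<subseteq> complete_graph n"
  shows "comb c = (\<Sum>p\<in>E. c p *\<^sub>R root_vec p)"
  unfolding comb_def using assms by (intro sum.mono_neutral_right) (auto simp: supp_def)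

lemma graph_cone_eq: "graph_cone e E = {\<Sum>p\<in>E. c p *\<^sub>R root_vec p | c. \<forall>p\<in>E. 0 \<le> c p}"
  by (simp add: graph_cone_def root_vec_def case_prod_unfold)

lemma mem_graph_cone_iff:
  assumes "E \<subseteq> complete_graph n"
  shows "x \<in> graph_cone e E \<longleftrightarrow> (\<exists>c. (\<forall>p. 0 \<le> c p) \<and> supp c \<subseteq> E \<and> x = comb c)"
proof
  assume "x \<in> graph_cone e E"
  then obtain c where c: "\<forall>p\<in>E. 0 \<le> c p" "x = (\<Sum>p\<in>E. c p *\<^sub>R root_vec p)"
    by (auto simp: graph_cone_eq)
  \<comment> \<open>Coefficients off \<open>E\<close> are set to 0, which turns the sum over
    \<open>E\<close> into a value of \<open>comb\<close>.\<close>
  define d where "d = (\<lambda>p. if p \<in> E then c p else 0)"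
  have d: "supp d \<subseteq> E" by (auto simp: d_def supp_def)
  have "x = comb d" unfolding comb_supp[OF d assms] c by (intro sum.cong) (auto simp: d_def)
  then show "\<exists>c. (\<forall>p. 0 \<le> c p) \<and> supp c \<subseteq> E \<and> x = comb c"
    using c d by (intro exI[of _ d]) (auto simp: d_def)
next
  assume "\<exists>c. (\<forall>p. 0 \<le> c p) \<and> supp c \<subseteq> E \<and> x = comb c"
  then show "x \<in> graph_cone e E"
    using comb_supp[OF _ assms] by (auto simp: graph_cone_eq)
qed

lemma mem_na_cone_iff:
  assumes "na_graph n F"
  shows "x \<in> graph_cone e F \<longleftrightarrow> (\<exists>c. na_flow n c \<and> supp c \<subseteq> F \<and> x = comb c)"
proof -
  have "na_flow n c \<longleftrightarrow> (\<forall>p. 0 \<le> c p)" if "supp c \<subseteq> F" for c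
    using that na_graph_subset[OF assms] unfolding na_flow_def by blast
  then show ?thesis
    using assms mem_graph_cone_iff[of F x] unfolding na_graph_def by blast
qed

text \<open>Replacing the coefficients of the point by the greedy flow with the same excesses keeps
  the point, and the support of that flow serves as \<open>F\<close>.\<close>

lemma cone_covered:
  assumes "x \<in> graph_cone e (complete_graph n)"
  obtains F where "na_graph n F" "x \<in> graph_cone e F"
proof -
  obtain c where c: "\<forall>p. 0 \<le> c p" "x = comb c"
    using assms mem_graph_cone_iff by blast
  obtain d where d: "na_flow n d" "net n d = net n c"
    using na_flow_exists[of n c] c by blast
  then have "x = comb d" using c comb_eq_iff by simp
  moreover have "na_graph n (supp d)" using d by (simp add: na_flow_def)
  ultimately show ?thesis using that mem_na_cone_iff d by blast
qed

text \<open>A point of all the cones has one flow supported in each \<open>F\<close>; by uniqueness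
  these flows coincide, so their common support lies in the intersection of the graphs.\<close>

lemma cone_Inter:
  assumes "\<And>F. F \<in> \<F> \<Longrightarrow> na_graph n F" "\<F> \<noteq> {}"
  shows "(\<Inter>F\<in>\<F>. graph_cone e F) = graph_cone e (\<Inter>\<F>)"
proof
  obtain F0 where F0: "F0 \<in> \<F>" using assms by blast
  have na: "na_graph n (\<Inter>\<F>)" using na_graph_subset[of n F0 "\<Inter>\<F>"] assms F0 by blast
  show "(\<Inter>F\<in>\<F>. graph_cone e F) \<subseteq> graph_cone e (\<Inter>\<F>)"
  proof
    fix x assume x: "x \<in> (\<Inter>F\<in>\<F>. graph_cone e F)"
    obtain c where c: "na_flow n c" "x = comb c"
      using x F0 assms mem_na_cone_iff by blast
    have "supp c \<subseteq> F" if F: "F \<in> \<F>" for F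
    proof -
      obtain d where "na_flow n d" "supp d \<subseteq> F" "x = comb d"
        using x F assms mem_na_cone_iff by blast
      then show ?thesis using comb_unique[OF c(1), of d] c(2) by simp
    qed
    then show "x \<in> graph_cone e (\<Inter>\<F>)" using mem_na_cone_iff[OF na] c by blast
  qed
  show "graph_cone e (\<Inter>\<F>) \<subseteq> (\<Inter>F\<in>\<F>. graph_cone e F)"
  proof (intro INT_greatest subsetI)
    fix F x assume F: "F \<in> \<F>" and "x \<in> graph_cone e (\<Inter>\<F>)"
    then obtain c where "na_flow n c" "supp c \<subseteq> \<Inter>\<F>" "x = comb c"
      using mem_na_cone_iff[OF na] by blast
    then show "x \<in> graph_cone e F"
      using mem_na_cone_iff[OF assms(1)[OF F]] F by blast
  qed
qed

section \<open>Linear independence, connectedness and acyclicity\<close>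

lemma inj_on_root: "inj_on root_vec (complete_graph n)"
proof (rule inj_onI)
  fix p q assume p: "p \<in> complete_graph n" and q: "q \<in> complete_graph n" and eq: "root_vec p = root_vec q"
  have *: "(of_bool (fst p = v) - of_bool (snd p = v) :: real)
      = of_bool (fst q = v) - of_bool (snd q = v)" if "v \<in> {1..n}" for v
    using inner_root[OF p that] inner_root[OF q that] eq by simp
  have "fst p \<in> {1..n}" "snd p \<in> {1..n}" "fst p \<noteq> snd p"
    using p by (auto simp: complete_graph_def)
  then show "p = q"
    using *[of "fst p"] *[of "snd p"] by (auto simp: of_bool_def prod_eq_iff split: if_splits)
qed

text \<open>The positive part \<open>c 1\<close> and the negative part \<open>c (-1)\<close> of a
  linear relation are flows on \<open>F\<close> that represent the same point. By uniqueness they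
  are equal, which forces all coefficients to be 0.\<close>

lemma independent_roots:
  assumes F: "na_graph n F"
  shows "independent (root_vec ` F)"
proof
  have FK: "F \<subseteq> complete_graph n" using F by (simp add: na_graph_def)
  have inj: "inj_on root_vec F" using inj_on_root FK by (rule inj_on_subset)
  assume "dependent (root_vec ` F)"
  then obtain u where u: "\<exists>v\<in>root_vec ` F. u v \<noteq> 0" "(\<Sum>v\<in>root_vec ` F. u v *\<^sub>R v) = 0"
    using dependent_finite[of "root_vec ` F"] na_graph_finite[OF F] by auto
  define c where "c = (\<lambda>s p. if p \<in> F then max 0 (s * u (root_vec p)) else 0)"
  have supp: "supp (c s) \<subseteq> F" for s by (auto simp: c_def supp_def)
  have flow: "na_flow n (c s)" for s
    using na_graph_subset[OF F supp] by (simp add: na_flow_def c_def)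
  have "comb (c 1) - comb (c (-1)) = (\<Sum>p\<in>F. u (root_vec p) *\<^sub>R root_vec p)"
    unfolding comb_supp[OF supp FK] sum_subtractf[symmetric] scaleR_diff_left[symmetric]
    by (intro sum.cong) (auto simp: c_def max_def)
  also have "\<dots> = 0" using u(2) by (simp add: sum.reindex[OF inj])
  finally have "c 1 = c (-1)" using comb_unique[OF flow flow] by simp
  then have "c 1 p = c (-1) p" for p by simp
  then have "max 0 (u (root_vec p)) = max 0 (- u (root_vec p))" if "p \<in> F" for p
    using that by (metis (mono_tags, lifting) c_def mult_1 mult_minus1)
  then have "u (root_vec p) = 0" if "p \<in> F" for p using that by (fastforce simp: max_def split: if_splits)
  with u(1) show False by blast
qed

lemma adjacent_in_span: "adjacent F u v \<Longrightarrow> e u - e v \<in> span (root_vec ` F)"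
  unfolding adjacent_def
proof (elim disjE)
  assume "(u, v) \<in> F"
  then show ?thesis using span_base[OF imageI[of "(u, v)" F root_vec]] by (simp add: root_vec_def[of "(u, v)"])
next
  assume "(v, u) \<in> F"
  then show ?thesis
    using span_neg[OF span_base[OF imageI[of "(v, u)" F root_vec]]] by (simp add: root_vec_def[of "(v, u)"])
qed

lemma path_span:
  assumes "(adjacent F)\<^sup>*\<^sup>* u v"
  shows "e u - e v \<in> span (root_vec ` F)"
  using assms
proof (induction rule: rtranclp_induct)
  case base
  then show ?case by (simp add: span_zero)
next
  case (step y z)
  then show ?case using span_add[OF step.IH adjacent_in_span[OF step.hyps(2)]] by simp
qed

text \<open>Roots along a path telescope. Conversely, if \<open>v\<close> is unreachable from
  \<open>u\<close>, the sum \<open>a\<close> of the basis vectors over the component of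
  \<open>u\<close> is orthogonal to all roots of \<open>F\<close> but not to
  \<open>e u - e v\<close>.\<close>

lemma connected_iff_span:
  assumes F: "F \<subseteq> complete_graph n"
  shows "connected_graph n F \<longleftrightarrow> root_vec ` complete_graph n \<subseteq> span (root_vec ` F)"
proof
  assume "connected_graph n F"
  then show "root_vec ` complete_graph n \<subseteq> span (root_vec ` F)"
    using path_span by (auto simp: connected_graph_def root_vec_def complete_graph_def)
next
  assume sp: "root_vec ` complete_graph n \<subseteq> span (root_vec ` F)"
  have "(adjacent F)\<^sup>*\<^sup>* u v" if u: "u \<in> {1..n}" and v: "v \<in> {1..n}" for u v
  proof (rule ccontr)
    assume nc: "\<not> (adjacent F)\<^sup>*\<^sup>* u v"
    define A where "A = {w \<in> {1..n}. (adjacent F)\<^sup>*\<^sup>* u w}"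
    define a where "a = (\<Sum>w\<in>A. e w)"
    have in_A: "e w \<bullet> a = of_bool (w \<in> A)" if "w \<in> {1..n}" for w
    proof -
      have "e w \<bullet> a = (\<Sum>x\<in>A. of_bool (w = x))"
        unfolding a_def inner_sum_right using that by (intro sum.cong) (auto simp: A_def inner_e)
      also have "\<dots> = of_bool (w \<in> A)" by (simp add: A_def of_bool_def)
      finally show ?thesis .
    qed
    have "root_vec p \<bullet> a = 0" if p: "p \<in> F" for p
    proof -
      obtain i j where ij: "p = (i, j)" by fastforce
      have "i \<in> {1..n}" "j \<in> {1..n}" using p F ij by (auto simp: complete_graph_def)
      moreover have "adjacent F i j" "adjacent F j i" using p ij by (auto simp: adjacent_def)
      then have "i \<in> A \<longleftrightarrow> j \<in> A"
        using calculation unfolding A_def by (auto intro: rtranclp.rtrancl_into_rtrancl)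
      ultimately show ?thesis using ij by (simp add: root_vec_def inner_diff_left in_A)
    qed
    then have zero: "x \<bullet> a = 0" if "x \<in> span (root_vec ` F)" for x
      using that span_minimal[of "root_vec ` F" "{x. x \<bullet> a = 0}"] subspace_hyperplane2 by blast
    have "u \<noteq> v" using nc by auto
    then have "e u - e v \<in> span (root_vec ` F)"
    proof (cases "u < v")
      case True
      then have "(u, v) \<in> complete_graph n" using u v by (simp add: complete_graph_def)
      then show ?thesis using sp by (auto simp: root_vec_def)
    next
      case False
      then have "(v, u) \<in> complete_graph n" using u v \<open>u \<noteq> v\<close> by (simp add: complete_graph_def)
      then have "e v - e u \<in> span (root_vec ` F)" using sp by (auto simp: root_vec_def)
      then show ?thesis using span_neg by fastforce
    qed
    then have "(e u - e v) \<bullet> a = 0" by (rule zero)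
    moreover have "u \<in> A" "v \<notin> A" using u nc by (auto simp: A_def)
    ultimately show False using u v by (simp add: inner_diff_left in_A)
  qed
  then show "connected_graph n F" by (simp add: connected_graph_def)
qed

text \<open>Without its closing edge \<open>p\<close>, a cycle is still a path between the ends of
  \<open>p\<close>, so the root of \<open>p\<close> lies in the span of the other roots, against
  independence.\<close>

lemma na_acyclic:
  assumes F: "na_graph n F"
  shows "acyclic_graph F"
  unfolding acyclic_graph_def
proof
  assume "\<exists>vs. is_cycle F vs"
  then obtain vs where len: "3 \<le> length vs" and dist: "distinct vs"
    and adj: "\<And>m. m + 1 < length vs \<Longrightarrow> adjacent F (vs ! m) (vs ! (m + 1))"
    and closing: "adjacent F (last vs) (hd vs)"
    unfolding is_cycle_def by blast
  have ends: "last vs = vs ! (length vs - 1)" "hd vs = vs ! 0"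
    using len last_conv_nth[of vs] hd_conv_nth[of vs] by fastforce+
  obtain p where p: "p \<in> F" "p = (last vs, hd vs) \<or> p = (hd vs, last vs)"
    using closing by (auto simp: adjacent_def)
  have "(adjacent (F - {p}))\<^sup>*\<^sup>* (vs ! 0) (vs ! m)" if "m < length vs" for m
    using that
  proof (induction m)
    case 0
    then show ?case by simp
  next
    case (Suc m)
    have ne: "vs ! i \<noteq> vs ! j" if "i < length vs" "j < length vs" "i \<noteq> j" for i j
      using that dist by (simp add: nth_eq_iff_index_eq)
    \<comment> \<open>No path edge is the closing edge: for \<open>m = 0\<close> because
      \<open>vs ! 1\<close> is neither end of a list of length at least 3, otherwise because both
      vertices differ from the first.\<close>
    have "{vs ! m, vs ! (m + 1)} \<noteq> {last vs, hd vs}"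
    proof (cases "m = 0")
      case True
      have "vs ! 1 \<noteq> vs ! 0" using ne[of 1 0] len by linarith
      moreover have "vs ! 1 \<noteq> vs ! (length vs - 1)" using ne[of 1 "length vs - 1"] len by linarith
      ultimately
      show ?thesis unfolding ends True by (auto simp: doubleton_eq_iff)
    next
      case False
      have "vs ! m \<noteq> vs ! 0" using ne[of m 0] False Suc.prems by linarith
      moreover have "vs ! (m + 1) \<noteq> vs ! 0" using ne[of "m + 1" 0] Suc.prems by linarith
      ultimately show ?thesis unfolding ends by (auto simp: doubleton_eq_iff)
    qed
    then have "adjacent (F - {p}) (vs ! m) (vs ! Suc m)"
      using adj[of m] Suc.prems p(2) by (auto simp: adjacent_def)
    then show ?case using Suc by (auto intro: rtranclp.rtrancl_into_rtrancl)
  qed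
  then have "e (hd vs) - e (last vs) \<in> span (root_vec ` (F - {p}))"
    unfolding ends using path_span len by simp
  then have "root_vec p \<in> span (root_vec ` (F - {p}))"
    using p(2) span_neg[of "e (hd vs) - e (last vs)"] by (auto simp: root_vec_def)
  moreover have "root_vec ` (F - {p}) = root_vec ` F - {root_vec p}"
    using inj_on_image_set_diff[OF inj_on_root, of F "{p}"] F p(1) by (auto simp: na_graph_def)
  ultimately have "dependent (root_vec ` F)" using p(1) unfolding dependent_def by auto
  then show False using independent_roots[OF F] by simp
qed

text \<open>Independence of the roots supplies acyclicity, and connectedness is a spanning
  condition.\<close>

lemma na_tree_iff:
  "T \<in> noncrossing_alternating_trees n
    \<longleftrightarrow> na_graph n T \<and> root_vec ` complete_graph n \<subseteq> span (root_vec ` T)"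
  unfolding noncrossing_alternating_trees_def spanning_tree_def
  using na_acyclic connected_iff_span unfolding na_graph_def by auto

end

section \<open>The triangulation of the vertex figure\<close>

text \<open>The hyperplane misses the origin, so adjoining 0 raises the affine dimension by one and
  makes it the linear dimension.\<close>

lemma aff_dim_off_origin:
  fixes S :: "'a::euclidean_space set"
  assumes "S \<subseteq> {x. a \<bullet> x = b}" "b \<noteq> 0"
  shows "aff_dim S = int (dim S) - 1"
proof -
  have "affine hull S \<subseteq> {x. a \<bullet> x = b}"
    using assms(1) affine_hyperplane by (rule hull_minimal)
  then have "0 \<notin> affine hull S" using assms(2) by auto
  then have "aff_dim (insert 0 S) = aff_dim S + 1" by (simp add: aff_dim_insert)
  moreover have "aff_dim (insert 0 S) = int (dim (insert 0 S))"
    by (rule aff_dim_zero) (simp add: hull_inc)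
  moreover have "dim (insert 0 S) = dim S" by (metis dim_span span_insert_0)
  ultimately show ?thesis by simp
qed

section \<open>The root polytope of the path and its vertices\<close>

context root_system_coordinates
begin

lemma positive_roots_eq: "positive_roots e n = root_vec ` complete_graph n"
proof -
  have "positive_roots e n = (\<lambda>(i, j). e i - e j) ` complete_graph n"
    unfolding positive_roots_def complete_graph_def by auto
  then show ?thesis by (simp add: root_vec_def case_prod_unfold cong: image_cong_simp)
qed

lemma convex_graph_cone: "convex (graph_cone e E)"
proof (rule convexI)
  fix x y and u v :: real
  assume xy: "x \<in> graph_cone e E" "y \<in> graph_cone e E" and uv: "0 \<le> u" "0 \<le> v" "u + v = 1"
  obtain c where c: "\<forall>p\<in>E. 0 \<le> c p" "x = (\<Sum>p\<in>E. c p *\<^sub>R root_vec p)"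
    using xy(1) by (auto simp: graph_cone_eq)
  obtain d where d: "\<forall>p\<in>E. 0 \<le> d p" "y = (\<Sum>p\<in>E. d p *\<^sub>R root_vec p)"
    using xy(2) by (auto simp: graph_cone_eq)
  have "u *\<^sub>R x + v *\<^sub>R y = (\<Sum>p\<in>E. (u * c p + v * d p) *\<^sub>R root_vec p)"
    unfolding c d by (simp add: scaleR_sum_right scaleR_add_left sum.distrib)
  moreover have "\<forall>p\<in>E. 0 \<le> u * c p + v * d p" using c d uv by simp
  ultimately show "u *\<^sub>R x + v *\<^sub>R y \<in> graph_cone e E"
    unfolding graph_cone_eq by (intro CollectI exI[of _ "\<lambda>p. u * c p + v * d p"]) simp
qed

lemma scaled_root_in_cone:
  assumes "E \<subseteq> complete_graph n" "p \<in> E" "0 \<le> t"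
  shows "t *\<^sub>R root_vec p \<in> graph_cone e E"
proof -
  let ?c = "\<lambda>q. t * of_bool (q = p)"
  have fin: "finite E" using assms(1) by (rule finite_subset) simp
  have "(\<Sum>q\<in>E. ?c q *\<^sub>R root_vec q) = (\<Sum>q\<in>E. if q = p then t *\<^sub>R root_vec p else 0)"
    by (intro sum.cong) auto
  also have "\<dots> = t *\<^sub>R root_vec p" using assms(2) fin by simp
  finally have "t *\<^sub>R root_vec p = (\<Sum>q\<in>E. ?c q *\<^sub>R root_vec q)" ..
  moreover have "\<forall>q\<in>E. 0 \<le> ?c q" using assms(3) by simp
  ultimately show ?thesis unfolding graph_cone_eq by (intro CollectI exI[of _ ?c]) simp
qed

lemma zero_in_cone: "0 \<in> graph_cone e E"
  unfolding graph_cone_eq by (intro CollectI exI[of _ "\<lambda>_. 0"]) simp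

text \<open>A positive root is the telescoping sum of the simple roots between its two
  indices.\<close>

lemma root_in_path_cone:
  assumes "p \<in> complete_graph n"
  shows "root_vec p \<in> graph_cone e (path_graph n)"
proof -
  let ?c = "\<lambda>q. of_bool (fst p \<le> fst q \<and> fst q < snd p) :: real"
  have p: "1 \<le> fst p" "fst p < snd p" "snd p \<le> n" using assms by (auto simp: complete_graph_def)
  have path: "path_graph n = (\<lambda>i. (i, i + 1)) ` {1..<n}" by (auto simp: path_graph_def)
  have "(\<Sum>q\<in>path_graph n. ?c q *\<^sub>R root_vec q)
      = (\<Sum>i\<in>{1..<n}. of_bool (fst p \<le> i \<and> i < snd p) *\<^sub>R (e i - e (i + 1)))"
    unfolding path by (subst sum.reindex) (auto simp: inj_on_def root_vec_def)
  also have "\<dots> = (\<Sum>i\<in>{fst p..<snd p}. e i - e (Suc i))"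
    using p by (intro sum.mono_neutral_cong_right) auto
  also have "\<dots> = - (\<Sum>i\<in>{fst p..<snd p}. e (Suc i) - e i)"
    by (simp add: sum_negf[symmetric])
  also have "\<dots> = root_vec p" using p by (simp add: sum_Suc_diff' root_vec_def)
  finally have "root_vec p = (\<Sum>q\<in>path_graph n. ?c q *\<^sub>R root_vec q)" ..
  then show ?thesis unfolding graph_cone_eq by (intro CollectI exI[of _ ?c]) simp
qed

lemma root_polytope_path: "root_polytope e n (path_graph n) = convex hull (insert 0 (root_vec ` complete_graph n))"
proof -
  have "root_vec ` complete_graph n \<inter> graph_cone e (path_graph n) = root_vec ` complete_graph n"
    using root_in_path_cone by blast
  then show ?thesis by (simp add: root_polytope_def positive_roots_eq)
qed

lemma norm_root:
  assumes "p \<in> complete_graph n"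
  shows "norm (root_vec p) = sqrt 2"
proof -
  have "fst p \<in> {1..n}" "snd p \<in> {1..n}" "fst p \<noteq> snd p"
    using assms by (auto simp: complete_graph_def)
  then show ?thesis
    by (simp add: norm_eq_sqrt_inner root_vec_def inner_diff_left inner_diff_right inner_e)
qed

text \<open>The polytope lies in the ball of radius \<open>sqrt 2\<close> whose boundary contains
  the roots, and an inner point of a segment is closer to the centre than one of the ends. A vertex
  figure constrains extreme points only, so this is what places every root beyond the
  hyperplane.\<close>

lemma root_extreme_point:
  assumes p: "p \<in> complete_graph n"
  shows "root_vec p extreme_point_of root_polytope e n (path_graph n)"
proof -
  have "insert 0 (root_vec ` complete_graph n) \<subseteq> cball 0 (sqrt 2)"
    using norm_root by auto
  then have ball: "root_polytope e n (path_graph n) \<subseteq> cball 0 (sqrt 2)"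
    unfolding root_polytope_path by (rule hull_minimal) simp
  have "root_vec p \<in> root_polytope e n (path_graph n)"
    unfolding root_polytope_path using p by (intro hull_inc) simp
  moreover have "root_vec p \<notin> open_segment x y"
    if "x \<in> root_polytope e n (path_graph n)" "y \<in> root_polytope e n (path_graph n)" for x y
  proof
    assume "root_vec p \<in> open_segment x y"
    then have "dist 0 (root_vec p) < dist 0 x \<or> dist 0 (root_vec p) < dist 0 y"
      by (rule dist_decreases_open_segment)
    then show False using that ball norm_root[OF p] by fastforce
  qed
  ultimately show ?thesis by (simp add: extreme_point_of_def)
qed

end

section \<open>Slices of cones by the hyperplane of the vertex figure\<close>

locale root_slice = root_system_coordinates n e
  for n :: nat and e :: "nat \<Rightarrow> 'a::euclidean_space" +
  fixes a :: 'a and b :: real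
  assumes b_pos: "0 < b" and root_above: "\<And>p. p \<in> complete_graph n \<Longrightarrow> b < a \<bullet> root_vec p"
begin

text \<open>The ray through the root meets the hyperplane here. By \<open>root_above\<close> the
  factor lies between 0 and 1 for roots of the complete graph, so the point is also on the segment
  from 0 to the root.\<close>

definition slice_vertex :: "nat \<times> nat \<Rightarrow> 'a" where
  "slice_vertex p = (b / (a \<bullet> root_vec p)) *\<^sub>R root_vec p"

definition cone_slice :: "(nat \<times> nat) set \<Rightarrow> 'a set" where
  "cone_slice E = graph_cone e E \<inter> {x. a \<bullet> x = b}"

lemma root_height: "p \<in> complete_graph n \<Longrightarrow> 0 < a \<bullet> root_vec p"
  using b_pos root_above[of p] by simp

lemma slice_vertex_height: "p \<in> complete_graph n \<Longrightarrow> a \<bullet> slice_vertex p = b"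
  using root_height[of p] by (simp add: slice_vertex_def)

lemma slice_vertex_in_cone:
  assumes "E \<subseteq> complete_graph n" "p \<in> E"
  shows "slice_vertex p \<in> graph_cone e E"
  unfolding slice_vertex_def
  using assms b_pos root_height[of p] by (intro scaled_root_in_cone) auto

lemma cone_slice_hull:
  assumes E: "E \<subseteq> complete_graph n"
  shows "cone_slice E = convex hull (slice_vertex ` E)"
proof
  have fin: "finite E" using E by (rule finite_subset) simp
  show "cone_slice E \<subseteq> convex hull (slice_vertex ` E)"
  proof
    fix x assume "x \<in> cone_slice E"
    then obtain c where c: "\<forall>p\<in>E. 0 \<le> c p" "x = (\<Sum>p\<in>E. c p *\<^sub>R root_vec p)" and ax: "a \<bullet> x = b"
      by (auto simp: cone_slice_def graph_cone_eq)
    \<comment> \<open>Rewriting the combination in terms of slice vertices rescales its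
      coefficients; they then add up to \<open>(a \<bullet> x) / b = 1\<close>.\<close>
    define w where "w = (\<lambda>p. c p * (a \<bullet> root_vec p) / b)"
    have "x = (\<Sum>p\<in>E. w p *\<^sub>R slice_vertex p)"
      unfolding c(2)
    proof (intro sum.cong refl)
      fix p assume "p \<in> E"
      then have "0 < a \<bullet> root_vec p" using E root_height by blast
      then show "c p *\<^sub>R root_vec p = w p *\<^sub>R slice_vertex p"
        using b_pos by (simp add: w_def slice_vertex_def)
    qed
    moreover have "(\<Sum>p\<in>E. w p) = 1"
    proof -
      have "(\<Sum>p\<in>E. w p) = (a \<bullet> x) / b"
        by (simp add: w_def c(2) inner_sum_right sum_divide_distrib)
      then show ?thesis using ax b_pos by simp
    qed
    moreover have "w p \<ge> 0" if "p \<in> E" for p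
      using c(1) E that root_height[of p] b_pos by (auto simp: w_def)
    ultimately show "x \<in> convex hull (slice_vertex ` E)"
      using convex_sum[OF fin convex_convex_hull, of w slice_vertex] by (simp add: hull_inc)
  qed
  have "convex (cone_slice E)"
    unfolding cone_slice_def using convex_graph_cone convex_hyperplane by (rule convex_Int)
  moreover have "slice_vertex ` E \<subseteq> cone_slice E"
    using E slice_vertex_in_cone slice_vertex_height by (auto simp: cone_slice_def)
  ultimately show "convex hull (slice_vertex ` E) \<subseteq> cone_slice E"
    by (intro hull_minimal)
qed

text \<open>The polytope is contained in the cone, since its generators are. Conversely, it contains
  the segments from 0 to the roots of \<open>E\<close>, hence all slice vertices and their
  hull.\<close>

lemma root_polytope_slice:
  assumes E: "E \<subseteq> complete_graph n"
  shows "root_polytope e n E \<inter> {x. a \<bullet> x = b} = cone_slice E"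
proof
  have "root_polytope e n E \<subseteq> graph_cone e E"
    unfolding root_polytope_def
    using zero_in_cone convex_graph_cone by (intro hull_minimal) auto
  then show "root_polytope e n E \<inter> {x. a \<bullet> x = b} \<subseteq> cone_slice E"
    by (auto simp: cone_slice_def)
  have "slice_vertex p \<in> root_polytope e n E" if p: "p \<in> E" for p
  proof -
    have pK: "p \<in> complete_graph n" using p E by blast
    have "root_vec p \<in> root_polytope e n E"
      unfolding root_polytope_def positive_roots_eq
      using scaled_root_in_cone[OF E p, of 1] pK by (intro hull_inc) simp
    moreover have "0 \<in> root_polytope e n E"
      unfolding root_polytope_def by (intro hull_inc) simp
    moreover have "convex (root_polytope e n E)" by (simp add: root_polytope_def)
    moreover have "0 \<le> b / (a \<bullet> root_vec p)" "b / (a \<bullet> root_vec p) \<le> 1"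
      using b_pos root_above[OF pK] by auto
    ultimately have "(1 - b / (a \<bullet> root_vec p)) *\<^sub>R 0 + (b / (a \<bullet> root_vec p)) *\<^sub>R root_vec p
        \<in> root_polytope e n E"
      unfolding convex_alt by blast
    then show ?thesis by (simp add: slice_vertex_def)
  qed
  then have "convex hull (slice_vertex ` E) \<subseteq> root_polytope e n E"
    unfolding root_polytope_def by (intro hull_minimal) auto
  then show "cone_slice E \<subseteq> root_polytope e n E \<inter> {x. a \<bullet> x = b}"
    using cone_slice_hull[OF E] by (auto simp: cone_slice_def)
qed

text \<open>Both the cone of the path and that of the complete graph contain all positive roots, so
  the two root polytopes coincide.\<close>

lemma root_polytope_path_slice:
  "root_polytope e n (path_graph n) \<inter> {x. a \<bullet> x = b} = cone_slice (complete_graph n)"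
proof -
  have "root_polytope e n (path_graph n) = root_polytope e n (complete_graph n)"
  proof -
    have "root_vec ` complete_graph n \<inter> graph_cone e (complete_graph n) = root_vec ` complete_graph n"
      using scaled_root_in_cone[OF subset_refl, of _ 1] by auto
    then show ?thesis
      unfolding root_polytope_path by (simp add: root_polytope_def positive_roots_eq)
  qed
  then show ?thesis using root_polytope_slice[OF subset_refl] by simp
qed

lemma cone_slice_mono:
  assumes "E \<subseteq> complete_graph n"
  shows "cone_slice E \<subseteq> cone_slice (complete_graph n)"
  unfolding cone_slice_hull[OF assms] cone_slice_hull[OF subset_refl]
  using assms by (intro hull_mono image_mono)

lemma root_polytope_Int_vertex_figure:
  assumes "E \<subseteq> complete_graph n"
  shows "root_polytope e n E \<inter> cone_slice (complete_graph n) = cone_slice E"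
proof -
  have "cone_slice (complete_graph n) \<subseteq> {x. a \<bullet> x = b}" by (auto simp: cone_slice_def)
  then show ?thesis
    using root_polytope_slice[OF assms] cone_slice_mono[OF assms] by blast
qed

lemma span_slice_vertices:
  assumes E: "E \<subseteq> complete_graph n"
  shows "span (slice_vertex ` E) = span (root_vec ` E)"
proof -
  have fin: "finite (root_vec ` E)" using E finite_subset[of E] by simp
  have "slice_vertex ` E = (\<lambda>x. (b / (a \<bullet> x)) *\<^sub>R x) ` root_vec ` E"
    by (simp add: slice_vertex_def image_image)
  moreover have "b / (a \<bullet> x) \<noteq> 0" if "x \<in> root_vec ` E" for x
    using that E root_height b_pos by force
  ultimately show ?thesis using span_image_scale[OF fin, of "\<lambda>x. b / (a \<bullet> x)"] by simp
qed

lemma aff_dim_cone_slice: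
  assumes E: "E \<subseteq> complete_graph n"
  shows "aff_dim (cone_slice E) = int (dim (root_vec ` E)) - 1"
proof -
  have "slice_vertex ` E \<subseteq> {x. a \<bullet> x = b}" using E slice_vertex_height by auto
  then have "aff_dim (slice_vertex ` E) = int (dim (slice_vertex ` E)) - 1"
    using b_pos by (intro aff_dim_off_origin) auto
  moreover have "dim (slice_vertex ` E) = dim (root_vec ` E)"
    using span_slice_vertices[OF E] by (metis dim_span)
  ultimately show ?thesis by (simp add: cone_slice_hull[OF E] aff_dim_convex_hull)
qed

text \<open>All roots have the same norm, so equal slice vertices have equal scaling
  factors.\<close>

lemma inj_on_slice_vertex: "inj_on slice_vertex (complete_graph n)"
proof (rule inj_onI)
  fix p q assume p: "p \<in> complete_graph n" and q: "q \<in> complete_graph n"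
    and eq: "slice_vertex p = slice_vertex q"
  define s t where "s = b / (a \<bullet> root_vec p)" and "t = b / (a \<bullet> root_vec q)"
  have pos: "s > 0" "t > 0" using root_height p q b_pos by (auto simp: s_def t_def)
  have st: "s *\<^sub>R root_vec p = t *\<^sub>R root_vec q" using eq by (simp add: slice_vertex_def s_def t_def)
  then have "norm (s *\<^sub>R root_vec p) = norm (t *\<^sub>R root_vec q)" by simp
  then have "s = t" using pos by (simp add: norm_root p q)
  then show "p = q" using st pos inj_onD[OF inj_on_root _ p q] by simp
qed

text \<open>The slice vertices are as many as the independent roots and span the same space, so they
  are even linearly independent.\<close>

lemma na_slice_independent:
  assumes F: "na_graph n F"
  shows "\<not> affine_dependent (slice_vertex ` F)"
proof -
  have FK: "F \<subseteq> complete_graph n" using F by (simp add: na_graph_def)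
  have "card (slice_vertex ` F) = card F"
    using inj_on_subset[OF inj_on_slice_vertex FK] by (rule card_image)
  also have "\<dots> = card (root_vec ` F)"
    using inj_on_subset[OF inj_on_root FK] by (simp add: card_image)
  also have "\<dots> = dim (root_vec ` F)"
    using independent_roots[OF F] by (simp add: dim_eq_card_independent)
  also have "\<dots> = dim (slice_vertex ` F)"
    using span_slice_vertices[OF FK] by (metis dim_span)
  finally have "independent (slice_vertex ` F)"
    using na_graph_finite[OF F] by (intro card_le_dim_spanning[OF _ span_superset]) auto
  then show ?thesis using affine_dependent_imp_dependent by blast
qed

section \<open>The simplicial complex and its top-dimensional simplices\<close>

lemma cone_slice_Int:
  assumes "na_graph n F" "na_graph n F'"
  shows "cone_slice F \<inter> cone_slice F' = cone_slice (F \<inter> F')"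
  using cone_Inter[of "{F, F'}"] assms by (auto simp: cone_slice_def)

text \<open>Under the inclusion, the slice of \<open>F\<close> is also the slice of the common
  subgraph. Each slice vertex of \<open>F\<close> is an extreme point of it, hence a slice vertex of
  the common subgraph. Applied both ways, this separates the slices of distinct trees.\<close>

lemma cone_slice_subset_iff:
  assumes F: "na_graph n F" and F': "na_graph n F'" and sub: "cone_slice F \<subseteq> cone_slice F'"
  shows "F \<subseteq> F'"
proof
  fix p assume p: "p \<in> F"
  have FK: "F \<subseteq> complete_graph n" using F by (simp add: na_graph_def)
  have na: "na_graph n (F \<inter> F')" using na_graph_subset[OF F] by blast
  have "cone_slice F = convex hull (slice_vertex ` (F \<inter> F'))"
    using cone_slice_Int[OF F F'] sub cone_slice_hull[of "F \<inter> F'"] FK by blast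
  then have "convex hull (slice_vertex ` F) = convex hull (slice_vertex ` (F \<inter> F'))"
    using cone_slice_hull[OF FK] by simp
  moreover have "slice_vertex p extreme_point_of convex hull (slice_vertex ` F)"
    using extreme_point_of_convex_hull_affine_independent[OF na_slice_independent[OF F]] p by simp
  ultimately have "slice_vertex p \<in> slice_vertex ` (F \<inter> F')"
    using extreme_point_of_convex_hull by metis
  then show "p \<in> F'" using inj_onD[OF inj_on_slice_vertex] p FK by blast
qed

text \<open>The empty graph is included: its slice is empty and provides the empty face that closure
  under faces demands.\<close>

definition na_complex :: "'a set set" where
  "na_complex = cone_slice ` {F. na_graph n F}"

text \<open>Faces of a simplex are hulls of subsets of its vertices, hence slices of subgraphs, and
  two simplices meet in the slice of their common subgraph.\<close>

lemma simplicial_complex_na_complex: "simplicial_complex na_complex"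
  unfolding simplicial_complex_def
proof (intro conjI ballI allI impI)
  have "finite {F. na_graph n F}"
    by (rule finite_subset[of _ "Pow (complete_graph n)"]) (auto simp: na_graph_def)
  then show "finite na_complex" unfolding na_complex_def by (rule finite_imageI)
next
  fix S assume "S \<in> na_complex"
  then obtain F where F: "na_graph n F" "S = cone_slice F" by (auto simp: na_complex_def)
  then have "S = convex hull (slice_vertex ` F)" using cone_slice_hull by (simp add: na_graph_def)
  then show "\<exists>k. k simplex S"
    unfolding simplex_def using na_slice_independent[OF F(1)]
    by (intro exI[of _ "int (card (slice_vertex ` F)) - 1"] exI[of _ "slice_vertex ` F"]) simp
next
  fix G S assume "S \<in> na_complex \<and> G face_of S"
  then obtain F where F: "na_graph n F" "G face_of cone_slice F" by (auto simp: na_complex_def)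
  have FK: "F \<subseteq> complete_graph n" using F by (simp add: na_graph_def)
  obtain c where c: "c \<subseteq> slice_vertex ` F" "G = convex hull c"
    using F(2) face_of_convex_hull_affine_independent[OF na_slice_independent[OF F(1)]]
    unfolding cone_slice_hull[OF FK] by blast
  obtain F' where F': "F' \<subseteq> F" "c = slice_vertex ` F'" using c(1) by (auto simp: subset_image_iff)
  have "G = cone_slice F'" using c(2) F' FK cone_slice_hull[of F'] by auto
  then show "G \<in> na_complex" using na_graph_subset[OF F(1) F'(1)] by (auto simp: na_complex_def)
next
  fix S S' assume "S \<in> na_complex \<and> S' \<in> na_complex"
  then obtain F F' where F: "na_graph n F" "S = cone_slice F" "na_graph n F'" "S' = cone_slice F'"
    by (auto simp: na_complex_def)
  have FK: "F \<subseteq> complete_graph n" using F by (simp add: na_graph_def)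
  have "S \<inter> S' = convex hull (slice_vertex ` (F \<inter> F'))"
    using F cone_slice_Int cone_slice_hull[of "F \<inter> F'"] FK by auto
  then show "S \<inter> S' face_of S"
    using face_of_convex_hull_affine_independent[OF na_slice_independent[OF F(1)]]
      cone_slice_hull[OF FK] F(2) by (metis Int_lower1 image_mono)
qed

lemma Union_na_complex: "\<Union>na_complex = cone_slice (complete_graph n)"
proof
  show "\<Union>na_complex \<subseteq> cone_slice (complete_graph n)"
    using cone_slice_mono by (auto simp: na_complex_def na_graph_def)
  show "cone_slice (complete_graph n) \<subseteq> \<Union>na_complex"
  proof
    fix x assume x: "x \<in> cone_slice (complete_graph n)"
    then obtain F where "na_graph n F" "x \<in> graph_cone e F"
      using cone_covered by (auto simp: cone_slice_def)
    then show "x \<in> \<Union>na_complex" using x by (auto simp: na_complex_def cone_slice_def)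
  qed
qed

text \<open>The span of the roots of \<open>T\<close> is contained in that of all roots, so equal
  dimension means equal span, which characterises the trees.\<close>

lemma na_tree_iff_top_dim:
  "T \<in> noncrossing_alternating_trees n \<longleftrightarrow>
    na_graph n T \<and> aff_dim (cone_slice T) = aff_dim (cone_slice (complete_graph n))"
proof (cases "na_graph n T")
  case True
  then have TK: "T \<subseteq> complete_graph n" by (simp add: na_graph_def)
  have sub: "span (root_vec ` T) \<subseteq> span (root_vec ` complete_graph n)"
    using TK by (intro span_mono image_mono)
  have "dim (root_vec ` T) = dim (root_vec ` complete_graph n) \<longleftrightarrow>
      root_vec ` complete_graph n \<subseteq> span (root_vec ` T)"
  proof
    assume "dim (root_vec ` T) = dim (root_vec ` complete_graph n)"
    then have "span (root_vec ` T) = span (root_vec ` complete_graph n)"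
      using sub by (intro subspace_dim_equal) (auto simp: dim_span)
    then show "root_vec ` complete_graph n \<subseteq> span (root_vec ` T)" using span_superset[of "root_vec ` complete_graph n"] by simp
  next
    assume "root_vec ` complete_graph n \<subseteq> span (root_vec ` T)"
    then have "span (root_vec ` complete_graph n) \<subseteq> span (root_vec ` T)" by (simp add: span_minimal)
    then show "dim (root_vec ` T) = dim (root_vec ` complete_graph n)" using sub by (metis dim_span subset_antisym)
  qed
  then show ?thesis
    using True TK na_tree_iff aff_dim_cone_slice by auto
next
  case False
  then show ?thesis using na_tree_iff by blast
qed

lemma bij_betw_trees_top_simplices:
  "bij_betw cone_slice (noncrossing_alternating_trees n)
    (top_simplices na_complex (cone_slice (complete_graph n)))"
proof (rule bij_betw_imageI)
  show "inj_on cone_slice (noncrossing_alternating_trees n)"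
  proof (rule inj_onI)
    fix T T' assume "T \<in> noncrossing_alternating_trees n" "T' \<in> noncrossing_alternating_trees n"
      and eq: "cone_slice T = cone_slice T'"
    then have "na_graph n T" "na_graph n T'" using na_tree_iff by auto
    then show "T = T'" using cone_slice_subset_iff eq by (metis subset_antisym subset_refl)
  qed
  show "cone_slice ` noncrossing_alternating_trees n
      = top_simplices na_complex (cone_slice (complete_graph n))"
    using na_tree_iff_top_dim by (auto simp: top_simplices_def na_complex_def)
qed

end

theorem theorem5p2:
  fixes n :: nat
    and e :: "nat \<Rightarrow> 'a::euclidean_space"
    and V :: "'a set"
  assumes "n \<ge> 2"
    and "bij_betw e {1..n} Basis"
    and "is_vertex_figure 0 (root_polytope e n (path_graph n)) V"
  shows "(\<exists>\<C>. triangulation_of \<C> V \<and>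
            bij_betw (\<lambda>T. root_polytope e n T \<inter> V)
              (noncrossing_alternating_trees n) (top_simplices \<C> V)) \<and>
         (\<forall>\<T>. \<T> \<subseteq> noncrossing_alternating_trees n \<and> \<T> \<noteq> {} \<longrightarrow>
            (\<Inter>T\<in>\<T>. root_polytope e n T) \<inter> V = root_polytope e n (\<Inter>\<T>) \<inter> V)"
proof -
  interpret root_system_coordinates n e using assms(2) by unfold_locales
  obtain a b where ab: "a \<bullet> 0 < b"
    "\<And>w. w extreme_point_of root_polytope e n (path_graph n) \<Longrightarrow> w \<noteq> 0 \<Longrightarrow> b < a \<bullet> w"
    and V: "V = root_polytope e n (path_graph n) \<inter> {x. a \<bullet> x = b}"
    using assms(3) unfolding is_vertex_figure_def by blast
  interpret root_slice n e a b
  proof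
    show "0 < b" using ab(1) by simp
    \<comment> \<open>Roots are extreme points and nonzero, having norm \<open>sqrt 2\<close>, so
      the vertex figure condition applies to them.\<close>
    show "b < a \<bullet> root_vec p" if "p \<in> complete_graph n" for p
      using ab(2) root_extreme_point[OF that] norm_root[OF that] by fastforce
  qed
  have V_slice: "V = cone_slice (complete_graph n)"
    unfolding V by (rule root_polytope_path_slice)
  have trees: "na_graph n T" "T \<subseteq> complete_graph n" if "T \<in> noncrossing_alternating_trees n" for T
    using that na_tree_iff by (auto simp: na_graph_def)
  have slice: "root_polytope e n E \<inter> V = cone_slice E" if "E \<subseteq> complete_graph n" for E
    unfolding V_slice using that by (rule root_polytope_Int_vertex_figure)
  have "triangulation_of na_complex V"
    unfolding triangulation_of_def V_slice
    using simplicial_complex_na_complex Union_na_complex by simp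
  moreover have "bij_betw (\<lambda>T. root_polytope e n T \<inter> V)
      (noncrossing_alternating_trees n) (top_simplices na_complex V)"
    using bij_betw_trees_top_simplices trees slice
    unfolding V_slice[symmetric] by (subst bij_betw_cong[where g = cone_slice]) auto
  moreover have "(\<Inter>T\<in>\<T>. root_polytope e n T) \<inter> V = root_polytope e n (\<Inter>\<T>) \<inter> V"
    if \<T>: "\<T> \<subseteq> noncrossing_alternating_trees n" "\<T> \<noteq> {}" for \<T>
  proof -
    \<comment> \<open>As the family is nonempty, \<open>V\<close> and the hyperplane can be moved in
      and out of the intersection; this reduces the claim to \<open>cone_Inter\<close>.\<close>
    have "(\<Inter>T\<in>\<T>. root_polytope e n T) \<inter> V = (\<Inter>T\<in>\<T>. root_polytope e n T \<inter> V)"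
      using \<T>(2) by blast
    also have "\<dots> = (\<Inter>T\<in>\<T>. cone_slice T)"
    proof -
      have "root_polytope e n T \<inter> V = cone_slice T" if "T \<in> \<T>" for T
        using that \<T>(1) by (intro slice trees(2)) blast
      then show ?thesis by simp
    qed
    also have "\<dots> = (\<Inter>T\<in>\<T>. graph_cone e T) \<inter> {x. a \<bullet> x = b}"
      unfolding cone_slice_def using \<T>(2) by blast
    also have "\<dots> = cone_slice (\<Inter>\<T>)"
      unfolding cone_slice_def using cone_Inter[of \<T>] \<T> trees by blast
    also have "\<dots> = root_polytope e n (\<Inter>\<T>) \<inter> V"
      using \<T> trees by (intro slice[symmetric]) blast
    finally show ?thesis .
  qed
  ultimately show ?thesis by blast
qed

end
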